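(* Thompson's quandle $P$, with generators $p_0,p_1,p_2,\dots$, has exactly two orbits, namely $[p_0]$ and $[p_1]=[p_2]=\cdots$.
   Context: A quandle is a set $Q$ with a binary operation $\rhd$ such that for every $x\in Q$ the left multiplication $y\mapsto x\rhd y$ is bijective, $x\rhd(y\rhd z)=(x\rhd y)\rhd(x\rhd z)$ for all $x,y,z$, and $x\rhd x=x$ for all $x$. Thompson's quandle $P$ is the quandle with generators $p_0,p_1,p_2,\dots$ and relations $p_j\rhd p_k=p_{k+1}$ for all $0\leqslant j<k$. The set of orbits $\mathrm{Orb}(Q)$ of a quandle $Q$ is the set of equivalence classes $[x]$ for the equivalence relation on $Q$ generated by $x\rhd y\sim y$ for all $x,y\in Q$. *)

theory Defs
  imports Main
begin

locale quandle =
  fixes Q :: "'a set"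
    and op :: "'a \<Rightarrow> 'a \<Rightarrow> 'a" (infixr "\<rhd>" 60)
  assumes bij_left: "x \<in> Q \<Longrightarrow> bij_betw (\<lambda>y. x \<rhd> y) Q Q"
    and left_distrib: "x \<in> Q \<Longrightarrow> y \<in> Q \<Longrightarrow> z \<in> Q \<Longrightarrow>
      x \<rhd> (y \<rhd> z) = (x \<rhd> y) \<rhd> (x \<rhd> z)"
    and idem: "x \<in> Q \<Longrightarrow> x \<rhd> x = x"
begin

definition orbit_rel :: "('a \<times> 'a) set" where
  "orbit_rel = {(a, b). a \<in> Q \<and> b \<in> Q \<and>
     equivclp (\<lambda>u v. v \<in> Q \<and> (\<exists>x\<in>Q. u = x \<rhd> v)) a b}"

definition orbit_of :: "'a \<Rightarrow> 'a set" where
  "orbit_of a = orbit_rel `` {a}"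

definition Orb :: "'a set set" where
  "Orb = Q // orbit_rel"

lemma op_closed: "x \<in> Q \<Longrightarrow> y \<in> Q \<Longrightarrow> x \<rhd> y \<in> Q"
  using bij_left by (auto simp: bij_betw_def)

lemma equiv_orbit_rel: "equiv Q orbit_rel"
  unfolding orbit_rel_def
  by (rule equivI) (auto simp: refl_on_def sym_def trans_def intro: equivclp_sym equivclp_trans)

end

(* Quandles given by generators and relations.  Terms have a second operation for the inverse
   of a left multiplication: Inv x is meant to be the inverse of the map y |-> x |> y.  Without it
   the quotient would in general not be a quandle (left multiplications need not be onto). *)

datatype 'g qterm = Gen 'g | Op "'g qterm" "'g qterm" | Inv "'g qterm" "'g qterm"

inductive qcong :: "('g qterm \<times> 'g qterm) set \<Rightarrow> 'g qterm \<Rightarrow> 'g qterm \<Rightarrow> bool"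
  for R where
  base: "(s, t) \<in> R \<Longrightarrow> qcong R s t"
| Op_Inv: "qcong R (Op s (Inv s t)) t"
| Inv_Op: "qcong R (Inv s (Op s t)) t"
| distrib: "qcong R (Op s (Op t u)) (Op (Op s t) (Op s u))"
| idem: "qcong R (Op s s) s"
| refl: "qcong R s s"
| sym: "qcong R s t \<Longrightarrow> qcong R t s"
| trans: "qcong R s t \<Longrightarrow> qcong R t u \<Longrightarrow> qcong R s u"
| Op_cong: "qcong R s s' \<Longrightarrow> qcong R t t' \<Longrightarrow> qcong R (Op s t) (Op s' t')"
| Inv_cong: "qcong R s s' \<Longrightarrow> qcong R t t' \<Longrightarrow> qcong R (Inv s t) (Inv s' t')"

definition qclass :: "('g qterm \<times> 'g qterm) set \<Rightarrow> 'g qterm \<Rightarrow> 'g qterm set" where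
  "qclass R t = {s. qcong R t s}"

definition presented_carrier :: "('g qterm \<times> 'g qterm) set \<Rightarrow> 'g qterm set set" where
  "presented_carrier R = range (qclass R)"

definition presented_op ::
  "('g qterm \<times> 'g qterm) set \<Rightarrow> 'g qterm set \<Rightarrow> 'g qterm set \<Rightarrow> 'g qterm set" where
  "presented_op R A B = {u. \<exists>s\<in>A. \<exists>t\<in>B. qcong R (Op s t) u}"

lemma qclass_eq_iff: "qclass R s = qclass R t \<longleftrightarrow> qcong R s t"
  unfolding qclass_def by (blast intro: qcong.refl qcong.sym qcong.trans)

lemma presented_op_qclass: "presented_op R (qclass R s) (qclass R t) = qclass R (Op s t)"
  unfolding qclass_def presented_op_def
  by (blast intro: qcong.refl qcong.sym qcong.trans qcong.Op_cong)

lemma quandle_presented: "quandle (presented_carrier R) (presented_op R)"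
proof
  fix x assume "x \<in> presented_carrier R"
  then obtain s where x: "x = qclass R s" by (auto simp: presented_carrier_def)
  have "inj_on (presented_op R x) (presented_carrier R)"
  proof (rule inj_onI)
    fix y z assume y: "y \<in> presented_carrier R" and z: "z \<in> presented_carrier R"
      and eq: "presented_op R x y = presented_op R x z"
    obtain t u where tu: "y = qclass R t" "z = qclass R u"
      using y z by (auto simp: presented_carrier_def)
    have "qcong R (Op s t) (Op s u)"
      using eq by (simp add: x tu presented_op_qclass qclass_eq_iff)
    then have "qcong R (Inv s (Op s t)) (Inv s (Op s u))"
      by (intro qcong.Inv_cong qcong.refl)
    then have "qcong R t u"
      by (blast intro: qcong.Inv_Op qcong.sym qcong.trans)
    then show "y = z" by (simp add: tu qclass_eq_iff)
  qed
  moreover have "presented_op R x ` presented_carrier R = presented_carrier R"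
  proof
    show "presented_op R x ` presented_carrier R \<subseteq> presented_carrier R"
      by (auto simp: presented_carrier_def x presented_op_qclass)
    show "presented_carrier R \<subseteq> presented_op R x ` presented_carrier R"
    proof
      fix y assume "y \<in> presented_carrier R"
      then obtain t where "y = qclass R t" by (auto simp: presented_carrier_def)
      then have "y = presented_op R x (qclass R (Inv s t))"
        by (simp add: x presented_op_qclass qclass_eq_iff qcong.Op_Inv qcong.sym)
      then show "y \<in> presented_op R x ` presented_carrier R"
        by (auto simp: presented_carrier_def)
    qed
  qed
  ultimately show "bij_betw (presented_op R x) (presented_carrier R) (presented_carrier R)"
    by (simp add: bij_betw_def)
qed (clarsimp simp: presented_carrier_def presented_op_qclass qclass_eq_iff
      qcong.idem qcong.distrib)+

(* The universal property, for arbitrary quandles Q; uniqueness is on the carrier. *)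

primrec (in quandle) qeval :: "('g \<Rightarrow> 'a) \<Rightarrow> 'g qterm \<Rightarrow> 'a" where
  "qeval f (Gen g) = f g"
| "qeval f (Op s t) = qeval f s \<rhd> qeval f t"
| "qeval f (Inv s t) = inv_into Q (\<lambda>y. qeval f s \<rhd> y) (qeval f t)"

context quandle
begin

lemma inv_left:
  assumes "x \<in> Q" "y \<in> Q"
  shows "inv_into Q ((\<rhd>) x) y \<in> Q" "x \<rhd> inv_into Q ((\<rhd>) x) y = y"
    "inv_into Q ((\<rhd>) x) (x \<rhd> y) = y"
  using bij_left[OF assms(1)] assms(2)
  by (auto simp: bij_betw_def inv_into_f_f intro: inv_into_into f_inv_into_f[where f = "(\<rhd>) x"])

lemma qeval_closed: "(\<And>g. f g \<in> Q) \<Longrightarrow> qeval f t \<in> Q"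
  by (induction t) (auto simp: op_closed inv_left)

lemma qeval_cong:
  assumes "\<And>g. f g \<in> Q" and "\<And>s t. (s, t) \<in> R \<Longrightarrow> qeval f s = qeval f t" and "qcong R s t"
  shows "qeval f s = qeval f t"
  using assms(3)
  by (induction rule: qcong.induct)
    (auto simp: assms(2) inv_left qeval_closed[of f, OF assms(1)] op_closed idem
      intro: left_distrib)

theorem presented_universal:
  assumes f: "\<And>g. f g \<in> Q" and R: "\<And>s t. (s, t) \<in> R \<Longrightarrow> qeval f s = qeval f t"
  shows "\<exists>h. (\<forall>A\<in>presented_carrier R. h A \<in> Q) \<and> (\<forall>g. h (qclass R (Gen g)) = f g) \<and>
      (\<forall>A\<in>presented_carrier R. \<forall>B\<in>presented_carrier R. h (presented_op R A B) = h A \<rhd> h B) \<and>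
      (\<forall>h'. (\<forall>A\<in>presented_carrier R. h' A \<in> Q) \<and> (\<forall>g. h' (qclass R (Gen g)) = f g) \<and>
        (\<forall>A\<in>presented_carrier R. \<forall>B\<in>presented_carrier R. h' (presented_op R A B) = h' A \<rhd> h' B)
        \<longrightarrow> (\<forall>A\<in>presented_carrier R. h' A = h A))"
proof -
  define h where "h A = qeval f (SOME t. t \<in> A)" for A
  have h: "h (qclass R t) = qeval f t" for t
  proof -
    have "t \<in> qclass R t" by (simp add: qclass_def qcong.refl)
    then have "(SOME s. s \<in> qclass R t) \<in> qclass R t" by (rule someI)
    then show ?thesis
      using qeval_cong[OF f R] by (simp add: h_def qclass_def)
  qed
  have uniq: "h' (qclass R t) = qeval f t"
    if "\<forall>A\<in>presented_carrier R. h' A \<in> Q" "\<forall>g. h' (qclass R (Gen g)) = f g"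
      "\<forall>A\<in>presented_carrier R. \<forall>B\<in>presented_carrier R. h' (presented_op R A B) = h' A \<rhd> h' B"
    for h' t
  proof (induction t)
    case (Gen g) then show ?case using that by simp
  next
    case (Op s t)
    then show ?case using that(3)
      by (simp add: presented_carrier_def flip: presented_op_qclass)
  next
    case (Inv s t)
    have "qclass R t = presented_op R (qclass R s) (qclass R (Inv s t))"
      by (simp add: presented_op_qclass qclass_eq_iff qcong.Op_Inv qcong.sym)
    then have "h' (qclass R t) = h' (qclass R s) \<rhd> h' (qclass R (Inv s t))"
      using that(3) by (simp add: presented_carrier_def)
    moreover have "h' (qclass R (Inv s t)) \<in> Q"
      using that(1) by (simp add: presented_carrier_def)
    ultimately show ?case
      using Inv inv_left(3)[OF qeval_closed[of f s, OF f]] by simp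
  qed
  show ?thesis
    by (rule exI[of _ h])
      (auto simp: presented_carrier_def h presented_op_qclass qeval_closed[of f, OF f]
        intro: uniq[unfolded presented_carrier_def])
qed

end

definition thompson_rels :: "(nat qterm \<times> nat qterm) set" where
  "thompson_rels = {(Op (Gen j) (Gen k), Gen (k + 1)) | j k. j < k}"

abbreviation P_carrier :: "nat qterm set set" where
  "P_carrier \<equiv> presented_carrier thompson_rels"

abbreviation P_op :: "nat qterm set \<Rightarrow> nat qterm set \<Rightarrow> nat qterm set" where
  "P_op \<equiv> presented_op thompson_rels"

definition pgen :: "nat \<Rightarrow> nat qterm set" where
  "pgen k = qclass thompson_rels (Gen k)"

interpretation P: quandle P_carrier P_op
  by (rule quandle_presented)

end

theory Submission
  imports Defs
begin

text \<open>
  An operation \<open>x \<rhd> y\<close> or its inverse moves only \<open>y\<close>, so the orbit of an element written as a term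
  depends only on the generator reached by always descending into the right argument. Hence every
  orbit of a presented quandle contains a generator. For Thompson's quandle the relation
  \<open>p\<^sub>0 \<rhd> p\<^sub>k = p\<^sub>k\<^sub>+\<^sub>1\<close> with \<open>k \<ge> 1\<close> puts \<open>p\<^sub>k\<close> and \<open>p\<^sub>k\<^sub>+\<^sub>1\<close> into the same orbit, so
  \<open>[p\<^sub>0]\<close> and \<open>[p\<^sub>1]\<close> are the only orbits.

  They are distinct because the defining relations \<open>p\<^sub>j \<rhd> p\<^sub>k = p\<^sub>k\<^sub>+\<^sub>1\<close> have \<open>k > j \<ge> 0\<close>: on both sides
  the rightmost generator has a positive index. So whether that index is \<open>0\<close> is a property of the
  element and not only of the term, and it is constant on orbits. In other words, there is a
  homomorphism from \<open>P\<close> to the trivial quandle with two elements (the one with \<open>x \<rhd> y = y\<close>) which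
  separates \<open>p\<^sub>0\<close> from the other generators.
\<close>

context quandle
begin

lemma orbit_rel_op: "x \<in> Q \<Longrightarrow> y \<in> Q \<Longrightarrow> (x \<rhd> y, y) \<in> orbit_rel"
  by (auto simp: orbit_rel_def op_closed)

lemma orbit_of_eq_iff:
  "a \<in> Q \<Longrightarrow> b \<in> Q \<Longrightarrow> orbit_of a = orbit_of b \<longleftrightarrow> (a, b) \<in> orbit_rel"
  unfolding orbit_of_def by (rule eq_equiv_class_iff[OF equiv_orbit_rel])

lemma Orb_eq: "Orb = orbit_of ` Q"
  by (auto simp: Orb_def quotient_def orbit_of_def)

lemma orbit_of_op: "x \<in> Q \<Longrightarrow> y \<in> Q \<Longrightarrow> orbit_of (x \<rhd> y) = orbit_of y"
  by (simp add: orbit_of_eq_iff op_closed orbit_rel_op)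

lemma orbit_rel_invariant:
  assumes inv: "\<And>x y. x \<in> Q \<Longrightarrow> y \<in> Q \<Longrightarrow> c (x \<rhd> y) = c y"
    and rel: "(a, b) \<in> orbit_rel"
  shows "c a = c b"
proof -
  have "equivclp (\<lambda>u v. v \<in> Q \<and> (\<exists>x\<in>Q. u = x \<rhd> v)) a b"
    using rel by (simp add: orbit_rel_def)
  then show ?thesis
    by (induction rule: equivclp_induct) (auto simp: inv)
qed

end

primrec rightmost_gen :: "'g qterm \<Rightarrow> 'g" where
  "rightmost_gen (Gen g) = g"
| "rightmost_gen (Op s t) = rightmost_gen t"
| "rightmost_gen (Inv s t) = rightmost_gen t"

text \<open>
  The quandle axioms themselves never change the rightmost generator, so only the defining relations
  have to respect \<open>c\<close>; \<open>c \<circ> rightmost_gen\<close> is evaluation in the trivial quandle on the range of \<open>c\<close>.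
\<close>

lemma qcong_rightmost_gen:
  assumes "qcong R s t"
    and "\<And>s t. (s, t) \<in> R \<Longrightarrow> c (rightmost_gen s) = c (rightmost_gen t)"
  shows "c (rightmost_gen s) = c (rightmost_gen t)"
  using assms(1) by induction (auto simp: assms(2))

lemma orbit_of_qclass:
  "quandle.orbit_of (presented_carrier R) (presented_op R) (qclass R t) =
   quandle.orbit_of (presented_carrier R) (presented_op R) (qclass R (Gen (rightmost_gen t)))"
proof -
  interpret quandle "presented_carrier R" "presented_op R"
    by (rule quandle_presented)
  have carrier: "qclass R u \<in> presented_carrier R" for u
    by (simp add: presented_carrier_def)
  have Op: "orbit_of (qclass R (Op u v)) = orbit_of (qclass R v)" for u v
    using orbit_of_op[OF carrier carrier] by (simp add: presented_op_qclass)
  \<comment> \<open>Undoing the operation of \<open>u\<close> is again a step within the orbit, read backwards.\<close>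
  have Inv: "orbit_of (qclass R (Inv u v)) = orbit_of (qclass R v)" for u v
  proof -
    have "qclass R (Op u (Inv u v)) = qclass R v"
      by (simp add: qclass_eq_iff qcong.Op_Inv)
    then show ?thesis using Op[of u "Inv u v"] by simp
  qed
  show ?thesis by (induction t) (simp_all add: Op Inv)
qed

lemma pgen_in_carrier: "pgen k \<in> P_carrier"
  by (simp add: pgen_def presented_carrier_def)

lemma P_op_pgen: "j < k \<Longrightarrow> P_op (pgen j) (pgen k) = pgen (Suc k)"
  unfolding pgen_def presented_op_qclass qclass_eq_iff
  by (rule qcong.base) (auto simp: thompson_rels_def)

lemma orbit_of_pgen: "k \<ge> 1 \<Longrightarrow> P.orbit_of (pgen k) = P.orbit_of (pgen 1)"
proof (induction k rule: dec_induct)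
  case (step k)
  then show ?case
    using P.orbit_of_op[of "pgen 0" "pgen k"] P_op_pgen[of 0 k] by (simp add: pgen_in_carrier)
qed simp

lemma orbit_of_pgen_0_neq_1: "P.orbit_of (pgen 0) \<noteq> P.orbit_of (pgen 1)"
proof
  assume "P.orbit_of (pgen 0) = P.orbit_of (pgen 1)"
  then have rel: "(pgen 0, pgen 1) \<in> P.orbit_rel"
    by (simp add: P.orbit_of_eq_iff pgen_in_carrier)
  define c where "c A \<longleftrightarrow> (\<exists>t\<in>A. rightmost_gen t = 0)" for A :: "nat qterm set"
  have c: "c (qclass thompson_rels t) \<longleftrightarrow> rightmost_gen t = 0" for t
  proof -
    have "rightmost_gen s = 0 \<longleftrightarrow> rightmost_gen t = 0" if "qcong thompson_rels t s" for s
    proof -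
      have "(rightmost_gen t = 0) = (rightmost_gen s = 0)"
        using that by (rule qcong_rightmost_gen) (auto simp: thompson_rels_def)
      then show ?thesis by simp
    qed
    then show ?thesis by (auto simp: c_def qclass_def intro: qcong.refl)
  qed
  have "c (pgen 0) = c (pgen 1)"
    using _ rel by (rule P.orbit_rel_invariant)
      (auto simp: presented_carrier_def presented_op_qclass c)
  then show False by (simp add: pgen_def c)
qed

theorem proposition3p1:
  shows "card P.Orb = 2 \<and>
    P.Orb = {P.orbit_of (pgen 0), P.orbit_of (pgen 1)} \<and>
    (\<forall>k\<ge>1. P.orbit_of (pgen k) = P.orbit_of (pgen 1))"
proof -
  have "P.orbit_of A \<in> {P.orbit_of (pgen 0), P.orbit_of (pgen 1)}" if "A \<in> P_carrier" for A
  proof -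
    obtain t where "A = qclass thompson_rels t"
      using \<open>A \<in> P_carrier\<close> by (auto simp: presented_carrier_def)
    then have "P.orbit_of A = P.orbit_of (pgen (rightmost_gen t))"
      using orbit_of_qclass[of thompson_rels t] by (simp add: pgen_def)
    then show ?thesis
      using orbit_of_pgen[of "rightmost_gen t"] by (cases "rightmost_gen t") auto
  qed
  then have Orb: "P.Orb = {P.orbit_of (pgen 0), P.orbit_of (pgen 1)}"
    unfolding P.Orb_eq using pgen_in_carrier by blast
  then have "card P.Orb = 2"
    using orbit_of_pgen_0_neq_1 by simp
  then show ?thesis using Orb orbit_of_pgen by blast
qed

end
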